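(* For any given constants $1\le\alpha\le\gamma$, $$\mathbb{H}_3^n(\alpha,\gamma+1)\in\mathbb{T}\left(n,\ \frac{\alpha-1}{\sqrt{\alpha(\alpha+1)(\gamma+1)}},\ \left(2^{\frac{\gamma+\alpha}{\gamma}}\alpha^{-\frac{\alpha}{\gamma}}(\gamma+1)^{\frac{\alpha(\gamma+1)}{\gamma^2}}\left(\frac{\gamma}{\gamma-\alpha}\right)^{\frac{\gamma-\alpha}{\gamma}}+o(1)\right)^n\right),$$ where $n\ge2$ and $o(1)$ denotes a quantity (depending on $n,\alpha,\gamma$) tending to $0$ as $n\to\infty$ for fixed $\alpha,\gamma$.
   Context: $\|\cdot\|$ is the Euclidean norm and $\mathbb{S}^n=\{\mathbf{x}\in\mathbb{R}^n:\|\mathbf{x}\|=1\}$. For $\mathbf{v}\in\mathbb{S}^n$ and $-1\le\tau\le1$ let $\mathbb{B}^n(\mathbf{v},\tau)=\{\mathbf{x}\in\mathbb{S}^n:\mathbf{x}^{\rm T}\mathbf{v}\ge\tau\}$. A finite set $\mathbb{H}^n\subseteq\mathbb{S}^n$ is a $\tau$-hitting set if $\bigcup_{\mathbf{v}\in\mathbb{H}^n}\mathbb{B}^n(\mathbf{v},\tau)=\mathbb{S}^n$; $\mathbb{T}(n,\tau,m)$ is the collection of all $\tau$-hitting sets of $\mathbb{S}^n$ with at most $m$ elements. Definition of $\mathbb{H}_3^n(\alpha,\beta)$ for $\alpha\ge1$, $\beta\ge\alpha+1$. Let $m=\lceil\log_\beta(\alpha n)\rceil$. An admissible partition is a tuple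 $(I_1,\dots,I_m)$ of pairwise disjoint (possibly empty) sets with union $\{1,\dots,n\}$ such that $|I_k|=\lfloor \alpha n/\beta^{k-1}\rfloor$ for $k=2,\dots,m$ and $|I_1|=n-\sum_{k=2}^m|I_k|$. For an admissible partition let $$\mathbb{Z}^n(I_1,\dots,I_m)=\{\mathbf{z}\in\mathbb{R}^n: z_i\in\{\pm1,\pm\beta^{(k-1)/2}\}\text{ if } i\in I_k,\ k=1,\dots,m\},$$ let $\mathbb{Z}^n$ be the union of these sets over all admissible partitions, and $\mathbb{H}_3^n(\alpha,\beta)=\{\mathbf{z}/\|\mathbf{z}\|:\mathbf{z}\in\mathbb{Z}^n\}\subseteq\mathbb{S}^n$. Convention: when $\gamma=\alpha$ the factor $\left(\frac{\gamma}{\gamma-\alpha}\right)^{\frac{\gamma-\alpha}{\gamma}}$ is interpreted as $1$. *)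

theory Defs
  imports
    Complex_Main
    "HOL-Library.Disjoint_Sets"
    "Jordan_Normal_Form.Matrix"
begin

text \<open>The dimension \<open>n\<close> varies, so \<open>\<real>\<^sup>n\<close> is \<open>carrier_vec n :: real vec set\<close>.
  Coordinates are therefore indexed by \<open>{0..<n}\<close> instead of \<open>{1..n}\<close>.\<close>

definition vec_norm2 :: "real vec \<Rightarrow> real" where
  "vec_norm2 x = sqrt (x \<bullet> x)"

definition unit_sphere :: "nat \<Rightarrow> real vec set" where
  "unit_sphere n = {x \<in> carrier_vec n. vec_norm2 x = 1}"

definition spherical_cap :: "nat \<Rightarrow> real vec \<Rightarrow> real \<Rightarrow> real vec set" where
  "spherical_cap n v \<tau> = {x \<in> unit_sphere n. x \<bullet> v \<ge> \<tau>}"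

definition hitting_set :: "nat \<Rightarrow> real \<Rightarrow> real vec set \<Rightarrow> bool" where
  "hitting_set n \<tau> H \<longleftrightarrow>
     finite H \<and> H \<subseteq> unit_sphere n \<and> (\<Union>v\<in>H. spherical_cap n v \<tau>) = unit_sphere n"

text \<open>The cardinality bound \<open>M\<close> is real, since it need not be an integer.\<close>

definition hitting_sets :: "nat \<Rightarrow> real \<Rightarrow> real \<Rightarrow> real vec set set" where
  "hitting_sets n \<tau> M = {H. hitting_set n \<tau> H \<and> real (card H) \<le> M}"

definition num_parts :: "nat \<Rightarrow> real \<Rightarrow> real \<Rightarrow> nat" where
  "num_parts n \<alpha> \<beta> = nat \<lceil>log \<beta> (\<alpha> * real n)\<rceil>"

text \<open>A tuple \<open>(I\<^sub>1, \<dots>, I\<^sub>m)\<close> is a function on \<open>nat\<close> of which only the values on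
  \<open>{1..m}\<close> are used. Cardinalities are compared in \<open>int\<close> to avoid truncated subtraction.\<close>

definition admissible_partition ::
  "nat \<Rightarrow> real \<Rightarrow> real \<Rightarrow> (nat \<Rightarrow> nat set) \<Rightarrow> bool" where
  "admissible_partition n \<alpha> \<beta> I \<longleftrightarrow>
     disjoint_family_on I {1..num_parts n \<alpha> \<beta>} \<and>
     (\<Union>k\<in>{1..num_parts n \<alpha> \<beta>}. I k) = {0..<n} \<and>
     (\<forall>k\<in>{2..num_parts n \<alpha> \<beta>}. int (card (I k)) = \<lfloor>\<alpha> * real n / \<beta> ^ (k - 1)\<rfloor>) \<and>
     int (card (I 1)) = int n - (\<Sum>k=2..num_parts n \<alpha> \<beta>. int (card (I k)))"

definition Z_part :: "nat \<Rightarrow> real \<Rightarrow> real \<Rightarrow> (nat \<Rightarrow> nat set) \<Rightarrow> real vec set" where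
  "Z_part n \<alpha> \<beta> I =
     {z \<in> carrier_vec n. \<forall>k\<in>{1..num_parts n \<alpha> \<beta>}. \<forall>i\<in>I k.
        z $ i \<in> {1, - 1, \<beta> powr ((real k - 1) / 2), - (\<beta> powr ((real k - 1) / 2))}}"

definition Z_all :: "nat \<Rightarrow> real \<Rightarrow> real \<Rightarrow> real vec set" where
  "Z_all n \<alpha> \<beta> = (\<Union>I\<in>{I. admissible_partition n \<alpha> \<beta> I}. Z_part n \<alpha> \<beta> I)"

definition H3 :: "nat \<Rightarrow> real \<Rightarrow> real \<Rightarrow> real vec set" where
  "H3 n \<alpha> \<beta> = (\<lambda>z. (1 / vec_norm2 z) \<cdot>\<^sub>v z) ` Z_all n \<alpha> \<beta>"

text \<open>The convention at \<open>\<gamma> = \<alpha>\<close> must be explicit: in HOL the formula would give \<open>0 powr 0 = 0\<close>.\<close>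

definition gap_factor :: "real \<Rightarrow> real \<Rightarrow> real" where
  "gap_factor \<alpha> \<gamma> =
     (if \<gamma> = \<alpha> then 1 else (\<gamma> / (\<gamma> - \<alpha>)) powr ((\<gamma> - \<alpha>) / \<gamma>))"

end

theory Submission
  imports Defs "HOL-Real_Asymp.Real_Asymp"
begin

text \<open>Write \<open>\<beta> = \<gamma> + 1\<close>.

  Hitting. For a unit vector \<open>x\<close> put \<open>t i = \<alpha> n x\<^sub>i\<^sup>2\<close>, so that the \<open>t i\<close> sum to \<open>\<alpha> n\<close>. Round \<open>x\<close> to a grid
  point \<open>z\<close> by giving \<open>z\<^sub>i\<close> the sign of \<open>x\<^sub>i\<close> and as square the largest available power of \<open>\<beta>\<close> that is
  at most \<open>max 1 (t i)\<close>. By Markov's inequality at most \<open>\<alpha> n / \<beta> ^ (k - 1)\<close> of the \<open>t i\<close> reach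
  \<open>\<beta> ^ (k - 1)\<close>, which is exactly what the sizes of an admissible partition allow. The rounding satisfies
  \<open>z\<^sub>i\<^sup>2 \<le> 1 + t i\<close>, hence \<open>z \<bullet> z \<le> (1 + \<alpha>) n\<close>, and \<open>t i \<le> \<beta> z\<^sub>i\<^sup>2\<close>, hence \<open>x \<bullet> z \<ge> sqrt (\<alpha> n / \<beta>)\<close>
  (\<open>Z_all_approximates\<close>). The quotient \<open>x \<bullet> z / \<parallel>z\<parallel>\<close> is then at least \<open>\<alpha> / sqrt (\<alpha> (\<alpha> + 1) \<beta>)\<close>.

  Counting. A grid point is determined by a partition and one of two values on the innermost layer, one of
  four on the others. If \<open>n\<^sub>k\<close> are the sizes of the layers and \<open>q\<^sub>k\<close> positive weights, the number of
  partitions is at most \<open>(\<Sum>k. q\<^sub>k) ^ n\<close> divided by the product of the \<open>q\<^sub>k ^ n\<^sub>k\<close>, since this product is one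
  of the terms into which the power of the sum expands, with the multinomial coefficient as multiplicity
  (\<open>card_mult_weight_le\<close>). The weights are taken to be the limiting proportions, \<open>\<alpha> / \<beta> ^ (k - 1)\<close> on the
  outer layers and \<open>1 - \<alpha> / \<gamma> + 1 / n\<close> on the innermost one; the summand \<open>1 / n\<close> keeps the last weight
  positive when \<open>\<gamma> = \<alpha>\<close> and makes the power of the sum at most \<open>e\<close>. Since there are only \<open>O(ln n)\<close> layers,
  rounding their sizes costs a factor \<open>exp (O(ln\<^sup>2 n))\<close>, and the bound \<open>card_labellings_le\<close> is
  \<open>C ^ n\<close> up to a factor whose \<open>n\<close>-th root tends to \<open>1\<close>. The base \<open>C\<close> is the exponential of the entropy of the
  limiting proportions plus \<open>(1 + \<alpha> / \<gamma>) ln 2\<close> for the choice of the values.\<close>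

section \<open>Combinatorial tools\<close>

text \<open>The sets are enlarged one at a time: when the set with index \<open>k\<close> is left for last, the others are
  enlarged inside the complement of \<open>J k\<close>, and the counting hypothesis leaves enough room for it.\<close>

lemma disjoint_family_enlarge:
  assumes "finite K" "finite X" "disjoint_family_on J K"
    and "\<And>k. k \<in> K \<Longrightarrow> J k \<subseteq> X" "\<And>k. k \<in> K \<Longrightarrow> card (J k) \<le> s k"
    and "(\<Sum>k\<in>K. s k) \<le> card X"
  shows "\<exists>I. disjoint_family_on I K \<and> (\<forall>k\<in>K. J k \<subseteq> I k \<and> I k \<subseteq> X \<and> card (I k) = s k)"
  using assms
proof (induction K arbitrary: X rule: finite_induct)
  case empty
  then show ?case by (auto simp: disjoint_family_on_def)
next
  case (insert k K)
  have J: "J k \<subseteq> X" "card (J k) \<le> s k" using insert.prems by auto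
  have fin: "finite (J k)" using J(1) \<open>finite X\<close> by (rule finite_subset)
  have "\<exists>I. disjoint_family_on I K \<and>
      (\<forall>j\<in>K. J j \<subseteq> I j \<and> I j \<subseteq> X - J k \<and> card (I j) = s j)"
  proof (rule insert.IH)
    show "finite (X - J k)" "disjoint_family_on J K"
      using insert.prems by (auto simp: disjoint_family_on_def)
    show "J j \<subseteq> X - J k" if "j \<in> K" for j
      using insert.prems insert.hyps that by (fastforce simp: disjoint_family_on_def)
    show "card (J j) \<le> s j" if "j \<in> K" for j
      using insert.prems that by auto
    have "card (X - J k) = card X - card (J k)"
      using J fin by (simp add: card_Diff_subset)
    moreover have "s k + (\<Sum>j\<in>K. s j) \<le> card X" using insert.prems insert.hyps by simp
    ultimately show "(\<Sum>j\<in>K. s j) \<le> card (X - J k)" using J(2) by linarith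
  qed
  then obtain I where I: "disjoint_family_on I K"
    "\<And>j. j \<in> K \<Longrightarrow> J j \<subseteq> I j \<and> I j \<subseteq> X - J k \<and> card (I j) = s j" by auto
  define R where "R = X - (\<Union>j\<in>K. I j)"
  have "card (\<Union>j\<in>K. I j) = (\<Sum>j\<in>K. s j)"
  proof (subst card_UN_disjoint)
    show "\<forall>j\<in>K. finite (I j)" using I(2) \<open>finite X\<close> by (meson finite_Diff finite_subset)
  qed (use I insert.hyps in \<open>auto simp: disjoint_family_on_def\<close>)
  moreover have "(\<Union>j\<in>K. I j) \<subseteq> X" using I by auto
  moreover have "finite (\<Union>j\<in>K. I j)"
    using \<open>finite X\<close> \<open>(\<Union>j\<in>K. I j) \<subseteq> X\<close> finite_subset by blast
  ultimately have "s k \<le> card R"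
    using insert.prems insert.hyps unfolding R_def by (simp add: card_Diff_subset)
  moreover have "J k \<subseteq> R" using J I unfolding R_def by auto
  moreover have "finite R" using insert.prems unfolding R_def by auto
  ultimately obtain T where T: "J k \<subseteq> T" "T \<subseteq> R" "card T = s k"
    using exists_subset_between J by metis
  have "disjoint_family_on (I(k := T)) (insert k K)"
    using I(1) T insert.hyps unfolding R_def by (auto simp: disjoint_family_on_def)
  moreover have "\<forall>j\<in>insert k K. J j \<subseteq> (I(k := T)) j \<and> (I(k := T)) j \<subseteq> X
      \<and> card ((I(k := T)) j) = s j"
    using I(2) T unfolding R_def by auto
  ultimately show ?case by blast
qed

text \<open>This is the weighted form of the bound of a multinomial coefficient by one term of
  the multinomial expansion: \<open>(\<Sum>a\<in>A. w a) ^ card X\<close> expands into the weights of all maps \<open>X \<rightarrow> A\<close>.\<close>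

lemma card_mult_weight_le:
  fixes w :: "'a \<Rightarrow> real"
  assumes "finite X" "finite A" "\<And>a. a \<in> A \<Longrightarrow> 0 \<le> w a" "G \<subseteq> X \<rightarrow>\<^sub>E A"
    and "\<And>g. g \<in> G \<Longrightarrow> (\<Prod>i\<in>X. w (g i)) = W"
  shows "real (card G) * W \<le> (\<Sum>a\<in>A. w a) ^ card X"
proof -
  have "real (card G) * W = (\<Sum>g\<in>G. \<Prod>i\<in>X. w (g i))"
    using assms(5) by simp
  also have "\<dots> \<le> (\<Sum>g\<in>X \<rightarrow>\<^sub>E A. \<Prod>i\<in>X. w (g i))"
    using assms by (intro sum_mono2 finite_PiE prod_nonneg) auto
  also have "\<dots> = (\<Prod>i\<in>X. \<Sum>a\<in>A. w a)"
    using assms by (intro prod_sum_PiE[symmetric]) auto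
  finally show ?thesis by simp
qed

section \<open>Sizes of the layers\<close>

text \<open>The parameter \<open>\<beta>\<close> is \<open>\<gamma> + 1\<close>, so the second assumption says \<open>\<alpha> \<le> \<gamma>\<close>: it makes the outer layers
  fit into \<open>n\<close> coordinates.\<close>

locale layers =
  fixes \<alpha> \<beta> :: real
  assumes one_le_alpha: "1 \<le> \<alpha>" and alpha_le: "\<alpha> + 1 \<le> \<beta>"
begin

abbreviation m :: "nat \<Rightarrow> nat" where "m n \<equiv> num_parts n \<alpha> \<beta>"

definition layer_size :: "nat \<Rightarrow> nat \<Rightarrow> nat" where
  "layer_size n k = nat \<lfloor>\<alpha> * real n / \<beta> ^ (k - 1)\<rfloor>"

definition base_size :: "nat \<Rightarrow> nat" where
  "base_size n = n - (\<Sum>k=2..m n. layer_size n k)"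

lemma num_parts_bounds:
  assumes "n \<ge> 2"
  shows "1 \<le> m n" "\<alpha> * n \<le> \<beta> ^ m n" "real (m n) - 1 \<le> 1 + ln n / ln \<beta>"
proof -
  define l where "l = log \<beta> (\<alpha> * n)"
  have b: "1 < \<beta>" and an: "1 < \<alpha> * n"
    using one_le_alpha alpha_le assms mult_mono[of 1 \<alpha> 2 "real n"] by auto
  have l: "0 < l" using b an unfolding l_def by simp
  then have m: "real (m n) = of_int \<lceil>l\<rceil>" "0 < \<lceil>l\<rceil>" by (auto simp: num_parts_def l_def)
  then show "1 \<le> m n" by linarith
  have "\<alpha> * n = \<beta> powr l" using b an unfolding l_def by simp
  also have "\<dots> \<le> \<beta> powr real (m n)" using b m by (intro powr_mono) auto
  finally show "\<alpha> * n \<le> \<beta> ^ m n" using b by (simp add: powr_realpow)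
  have "l = ln \<alpha> / ln \<beta> + ln n / ln \<beta>"
    using one_le_alpha assms unfolding l_def log_def by (simp add: ln_mult add_divide_distrib)
  moreover have "ln \<alpha> / ln \<beta> \<le> 1" using b one_le_alpha alpha_le by simp
  moreover have "real (m n) < l + 1" using m by linarith
  ultimately show "real (m n) - 1 \<le> 1 + ln n / ln \<beta>" by linarith
qed

lemma sum_outer_fractions:
  assumes "1 \<le> M"
  shows "(\<Sum>k=2..M. \<alpha> / \<beta> ^ (k - 1)) = \<alpha> / (\<beta> - 1) - \<alpha> / (\<beta> - 1) / \<beta> ^ (M - 1)"
  using assms
proof (induction M rule: nat_induct_at_least)
  case base
  then show ?case by simp
next
  case (Suc M)
  obtain j where j: "M = Suc j" using Suc.hyps by (cases M) auto
  have b: "\<beta> > 1" using one_le_alpha alpha_le by linarith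
  define a where "a = \<alpha> / (\<beta> - 1)"
  have a: "\<alpha> = a * (\<beta> - 1)" using b unfolding a_def by simp
  have "(\<Sum>k=2..Suc M. \<alpha> / \<beta> ^ (k - 1)) = (\<Sum>k=2..M. \<alpha> / \<beta> ^ (k - 1)) + \<alpha> / \<beta> ^ M"
    using Suc.hyps by simp
  also have "\<dots> = a - a / \<beta> ^ (M - 1) + \<alpha> / \<beta> ^ M"
    using Suc.IH unfolding a_def by simp
  also have "\<alpha> / \<beta> ^ M = a / \<beta> ^ (M - 1) - a / \<beta> ^ M"
    using b unfolding j a by (simp add: field_simps)
  finally show ?case unfolding a_def by simp
qed

lemma real_layer_size:
  "real (layer_size n k) \<le> n * (\<alpha> / \<beta> ^ (k - 1))"
  "n * (\<alpha> / \<beta> ^ (k - 1)) - 1 \<le> real (layer_size n k)"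
proof -
  have "0 \<le> \<alpha> * real n / \<beta> ^ (k - 1)" using one_le_alpha alpha_le by simp
  then have "real (layer_size n k) = of_int \<lfloor>\<alpha> * real n / \<beta> ^ (k - 1)\<rfloor>"
    unfolding layer_size_def by simp
  then show "real (layer_size n k) \<le> n * (\<alpha> / \<beta> ^ (k - 1))"
    "n * (\<alpha> / \<beta> ^ (k - 1)) - 1 \<le> real (layer_size n k)"
    by (auto simp: mult.commute)
qed

lemma sum_layer_size_le:
  assumes "n \<ge> 2"
  shows "real (\<Sum>k=2..m n. layer_size n k) \<le> n * (\<alpha> / (\<beta> - 1))"
proof -
  have "real (\<Sum>k=2..m n. layer_size n k) \<le> (\<Sum>k=2..m n. n * (\<alpha> / \<beta> ^ (k - 1)))"
    unfolding of_nat_sum by (intro sum_mono real_layer_size)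
  also have "\<dots> = n * (\<alpha> / (\<beta> - 1) - \<alpha> / (\<beta> - 1) / \<beta> ^ (m n - 1))"
    unfolding sum_distrib_left[symmetric] sum_outer_fractions[OF num_parts_bounds(1)[OF assms]] ..
  also have "\<dots> \<le> n * (\<alpha> / (\<beta> - 1))"
    using one_le_alpha alpha_le by (intro mult_left_mono) auto
  finally show ?thesis .
qed

lemma sum_layer_size_le_dim:
  assumes "n \<ge> 2"
  shows "(\<Sum>k=2..m n. layer_size n k) \<le> n"
proof -
  have "\<alpha> / (\<beta> - 1) \<le> 1" using one_le_alpha alpha_le by simp
  then have "n * (\<alpha> / (\<beta> - 1)) \<le> real n" using mult_left_le[of "\<alpha> / (\<beta> - 1)" "real n"] by simp
  then show ?thesis using sum_layer_size_le[OF assms] by linarith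
qed

text \<open>Each of the \<open>m n - 1\<close> roundings costs at most one coordinate and the missing tail of the geometric series
  at most two, so the innermost layer exceeds its limiting proportion by \<open>O(ln n)\<close> only.\<close>

lemma base_size_bounds:
  assumes "n \<ge> 2"
  shows "n * (1 - \<alpha> / (\<beta> - 1)) \<le> base_size n"
    and "base_size n \<le> n * (1 - \<alpha> / (\<beta> - 1)) + (3 + ln n / ln \<beta>)"
proof -
  have eq: "real (base_size n) = n - real (\<Sum>k=2..m n. layer_size n k)"
    unfolding base_size_def using sum_layer_size_le_dim[OF assms] by (simp add: of_nat_diff)
  show "n * (1 - \<alpha> / (\<beta> - 1)) \<le> base_size n"
    using eq sum_layer_size_le[OF assms] by (simp add: right_diff_distrib)
  note mb = num_parts_bounds[OF assms]
  have b: "\<beta> \<ge> 2" using one_le_alpha alpha_le by linarith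
  have "n * (\<alpha> / (\<beta> - 1) - \<alpha> / (\<beta> - 1) / \<beta> ^ (m n - 1)) - (real (m n) - 1)
      = (\<Sum>k=2..m n. n * (\<alpha> / \<beta> ^ (k - 1)) - 1)"
    unfolding sum_subtractf sum_distrib_left[symmetric] sum_outer_fractions[OF mb(1)]
    using mb(1) by (simp add: of_nat_diff)
  also have "\<dots> \<le> real (\<Sum>k=2..m n. layer_size n k)"
    unfolding of_nat_sum by (intro sum_mono real_layer_size)
  finally have 1: "real (base_size n) \<le> n * (1 - \<alpha> / (\<beta> - 1))
      + n * (\<alpha> / (\<beta> - 1) / \<beta> ^ (m n - 1)) + (real (m n) - 1)"
    using eq by (simp add: algebra_simps)
  obtain j where j: "m n = Suc j" using mb(1) by (cases "m n") auto
  have "n * (\<alpha> / (\<beta> - 1) / \<beta> ^ (m n - 1)) = (\<alpha> * n) / ((\<beta> - 1) * \<beta> ^ j)"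
    using j by simp
  also have "\<dots> \<le> \<beta> ^ Suc j / ((\<beta> - 1) * \<beta> ^ j)"
    using mb(2) j b by (intro divide_right_mono) auto
  also have "\<dots> = \<beta> / (\<beta> - 1)" using b by simp
  also have "\<dots> \<le> 2" using b by (simp add: field_simps)
  finally show "base_size n \<le> n * (1 - \<alpha> / (\<beta> - 1)) + (3 + ln n / ln \<beta>)"
    using 1 mb(3) by linarith
qed

lemma card_admissible:
  assumes "admissible_partition n \<alpha> \<beta> I"
  shows "\<And>k. k \<in> {2..m n} \<Longrightarrow> card (I k) = layer_size n k" "card (I 1) = base_size n"
proof -
  show *: "card (I k) = layer_size n k" if "k \<in> {2..m n}" for k
  proof -
    have "int (card (I k)) = \<lfloor>\<alpha> * real n / \<beta> ^ (k - 1)\<rfloor>"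
      using assms that unfolding admissible_partition_def by blast
    then show ?thesis unfolding layer_size_def by linarith
  qed
  have "int (card (I 1)) = int n - (\<Sum>k=2..m n. int (card (I k)))"
    using assms unfolding admissible_partition_def by blast
  also have "\<dots> = int n - int (\<Sum>k=2..m n. layer_size n k)" using * by simp
  finally show "card (I 1) = base_size n" unfolding base_size_def by linarith
qed

text \<open>Filling up disjoint sets below the prescribed sizes gives an admissible partition; the coordinates
  that are added to an outer layer come from the innermost one.\<close>

lemma admissible_partition_extending:
  assumes n: "n \<ge> 2" and J: "disjoint_family_on J {2..m n}"
    "\<And>k. k \<in> {2..m n} \<Longrightarrow> J k \<subseteq> {0..<n} \<and> card (J k) \<le> layer_size n k"
  obtains I where "admissible_partition n \<alpha> \<beta> I" "\<And>k. k \<in> {2..m n} \<Longrightarrow> J k \<subseteq> I k"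
proof -
  have "\<exists>I. disjoint_family_on I {2..m n} \<and>
      (\<forall>k\<in>{2..m n}. J k \<subseteq> I k \<and> I k \<subseteq> {0..<n} \<and> card (I k) = layer_size n k)"
    using J sum_layer_size_le_dim[OF n] by (intro disjoint_family_enlarge) auto
  then obtain I where I: "disjoint_family_on I {2..m n}"
    "\<And>k. k \<in> {2..m n} \<Longrightarrow> J k \<subseteq> I k \<and> I k \<subseteq> {0..<n} \<and> card (I k) = layer_size n k" by auto
  define U where "U = (\<Union>k\<in>{2..m n}. I k)"
  define I' where "I' = I(1 := {0..<n} - U)"
  have split: "{1..m n} = insert 1 {2..m n}" using num_parts_bounds(1)[OF n] by auto
  have "U \<subseteq> {0..<n}" unfolding U_def using I(2) by blast
  have I'[simp]: "I' k = I k" if "k \<in> {2..m n}" for k using that unfolding I'_def by auto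
  have I'1: "I' 1 = {0..<n} - U" by (simp add: I'_def)
  have cardU: "card U = (\<Sum>k=2..m n. layer_size n k)"
    unfolding U_def
  proof (subst card_UN_disjoint)
    show "\<forall>k\<in>{2..m n}. finite (I k)" using I(2) by (meson finite_atLeastLessThan finite_subset)
  qed (use I in \<open>auto simp: disjoint_family_on_def\<close>)
  have "disjoint_family_on I' {1..m n}"
    using I(1) unfolding split disjoint_family_on_def I'_def U_def by auto
  moreover have "(\<Union>k\<in>{1..m n}. I' k) = {0..<n}"
  proof -
    have "(\<Union>k\<in>{1..m n}. I' k) = ({0..<n} - U) \<union> U"
      unfolding split U_def using I'1 by (auto simp: U_def)
    then show ?thesis using \<open>U \<subseteq> {0..<n}\<close> by auto
  qed
  moreover have "int (card (I' k)) = \<lfloor>\<alpha> * real n / \<beta> ^ (k - 1)\<rfloor>" if "k \<in> {2..m n}" for k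
    using that I one_le_alpha alpha_le by (auto simp: layer_size_def)
  moreover have "int (card (I' 1)) = int n - (\<Sum>k=2..m n. int (card (I' k)))"
  proof -
    have "card (I' 1) = n - card U"
      unfolding I'1 using \<open>U \<subseteq> {0..<n}\<close> by (simp add: card_Diff_subset finite_subset)
    moreover have "card U \<le> n" using cardU sum_layer_size_le_dim[OF n] by simp
    moreover have "(\<Sum>k=2..m n. int (card (I' k))) = int (card U)"
      using I cardU by simp
    ultimately show ?thesis by simp
  qed
  ultimately have "admissible_partition n \<alpha> \<beta> I'"
    unfolding admissible_partition_def by blast
  then show ?thesis using that[of I'] I by simp
qed

section \<open>The hitting property\<close>

lemma layer_value_square: "(\<beta> powr ((real k - 1) / 2))\<^sup>2 = \<beta> ^ (k - 1)" if "k \<ge> 1"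
proof -
  have "(\<beta> powr ((real k - 1) / 2))\<^sup>2 = \<beta> powr (real (k - 1))"
    using that by (simp add: power2_eq_square powr_add[symmetric] of_nat_diff)
  then show ?thesis using one_le_alpha alpha_le by (simp add: powr_realpow)
qed

text \<open>The layer \<open>\<kappa> i\<close> that is chosen for the coordinate \<open>i\<close> is the largest \<open>k\<close> with \<open>\<beta> ^ (k - 1) \<le> t i\<close>, and
  \<open>1\<close> if there is none. The coordinates with \<open>\<kappa> i = 1\<close> take the values \<open>1\<close> or \<open>- 1\<close>, which are permitted on every
  layer; they can therefore be used to fill up the outer layers to their prescribed sizes.\<close>

lemma Z_all_approximates:
  assumes n: "n \<ge> 2" and x: "x \<in> unit_sphere n"
  obtains z where "z \<in> Z_all n \<alpha> \<beta>" "z \<bullet> z \<le> (1 + \<alpha>) * n" "sqrt (\<alpha> * n / \<beta>) \<le> x \<bullet> z"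
proof -
  note mb = num_parts_bounds[OF n]
  have b: "\<beta> \<ge> 2" using one_le_alpha alpha_le by linarith
  have dx: "dim_vec x = n" and "vec_norm2 x = 1" using x unfolding unit_sphere_def by auto
  then have x1: "(\<Sum>i<n. (x $ i)\<^sup>2) = 1"
    by (simp add: vec_norm2_def scalar_prod_def power2_eq_square atLeast0LessThan)
  define t where "t i = \<alpha> * n * (x $ i)\<^sup>2" for i
  have t0: "0 \<le> t i" for i using one_le_alpha unfolding t_def by simp
  have sum_t: "(\<Sum>i<n. t i) = \<alpha> * n"
    unfolding t_def sum_distrib_left[symmetric] x1 by simp
  define L where "L i = {k \<in> {1..m n}. k = 1 \<or> \<beta> ^ (k - 1) \<le> t i}" for i
  define \<kappa> where "\<kappa> i = Max (L i)" for i
  have "\<kappa> i \<in> L i" for i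
    unfolding \<kappa>_def using mb(1) by (intro Max_in) (auto simp: L_def)
  then have kr: "\<kappa> i \<in> {1..m n}" and kt: "\<kappa> i \<noteq> 1 \<Longrightarrow> \<beta> ^ (\<kappa> i - 1) \<le> t i" for i
    unfolding L_def by auto
  \<comment> \<open>On the top layer this uses that no \<open>t i\<close> exceeds the sum \<open>\<alpha> * n \<le> \<beta> ^ m n\<close>.\<close>
  have t_le: "t i \<le> \<beta> ^ \<kappa> i" if "i < n" for i
  proof (cases "\<kappa> i = m n")
    case True
    have "t i \<le> (\<Sum>i<n. t i)" using that t0 by (intro member_le_sum) auto
    then show ?thesis using True mb(2) sum_t by simp
  next
    case False
    then have "Suc (\<kappa> i) \<in> {1..m n}" using kr[of i] by auto
    moreover have "Suc (\<kappa> i) \<notin> L i"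
    proof
      assume "Suc (\<kappa> i) \<in> L i"
      then have "Suc (\<kappa> i) \<le> \<kappa> i" unfolding \<kappa>_def by (intro Max_ge) (auto simp: L_def)
      then show False by simp
    qed
    ultimately show ?thesis unfolding L_def by auto
  qed
  define z where "z = vec n (\<lambda>i. (if 0 \<le> x $ i then 1 else - 1) * \<beta> powr ((real (\<kappa> i) - 1) / 2))"
  have z_sq: "(z $ i)\<^sup>2 = \<beta> ^ (\<kappa> i - 1)" if "i < n" for i
    using that layer_value_square[of "\<kappa> i"] kr[of i] unfolding z_def by simp
  define J where "J k = {i \<in> {0..<n}. \<kappa> i = k}" for k
  obtain I where I: "admissible_partition n \<alpha> \<beta> I" "\<And>k. k \<in> {2..m n} \<Longrightarrow> J k \<subseteq> I k"
  proof (rule admissible_partition_extending[OF n, of J])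
    show "disjoint_family_on J {2..m n}" by (auto simp: J_def disjoint_family_on_def)
    fix k assume k: "k \<in> {2..m n}"
    \<comment> \<open>Markov's inequality for the numbers \<open>t i\<close>, whose sum is \<open>\<alpha> * n\<close>\<close>
    have "real (card (J k)) * \<beta> ^ (k - 1) = (\<Sum>i\<in>J k. \<beta> ^ (k - 1))" by simp
    also have "\<dots> \<le> (\<Sum>i\<in>J k. t i)" using k kt by (intro sum_mono) (auto simp: J_def)
    also have "\<dots> \<le> (\<Sum>i<n. t i)" using t0 by (intro sum_mono2) (auto simp: J_def)
    finally have "real (card (J k)) \<le> \<alpha> * n / \<beta> ^ (k - 1)"
      using sum_t b by (simp add: pos_le_divide_eq)
    then have "int (card (J k)) \<le> \<lfloor>\<alpha> * n / \<beta> ^ (k - 1)\<rfloor>" by (simp add: le_floor_iff)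
    then show "J k \<subseteq> {0..<n} \<and> card (J k) \<le> layer_size n k"
      unfolding layer_size_def J_def by auto
  qed blast
  have "z \<in> Z_part n \<alpha> \<beta> I"
    unfolding Z_part_def
  proof (intro CollectI conjI ballI)
    show "z \<in> carrier_vec n" by (simp add: z_def)
    fix k i assume k: "k \<in> {1..m n}" and i: "i \<in> I k"
    have disj: "disjoint_family_on I {1..m n}" and "(\<Union>k\<in>{1..m n}. I k) = {0..<n}"
      using I(1) unfolding admissible_partition_def by auto
    then have "i < n" using i k by auto
    have "\<kappa> i = 1 \<or> \<kappa> i = k"
    proof (rule ccontr)
      assume *: "\<not> (\<kappa> i = 1 \<or> \<kappa> i = k)"
      then have "\<kappa> i \<in> {2..m n}" using kr[of i] by auto
      then have "i \<in> I (\<kappa> i)" using I(2) \<open>i < n\<close> by (auto simp: J_def)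
      then show False using disj k i * kr[of i] unfolding disjoint_family_on_def by blast
    qed
    then show "z $ i \<in> {1, - 1, \<beta> powr ((real k - 1) / 2), - (\<beta> powr ((real k - 1) / 2))}"
      using \<open>i < n\<close> b unfolding z_def by auto
  qed
  then have "z \<in> Z_all n \<alpha> \<beta>" using I(1) unfolding Z_all_def by blast
  moreover have "z \<bullet> z \<le> (1 + \<alpha>) * n"
  proof -
    have "z \<bullet> z = (\<Sum>i<n. (z $ i)\<^sup>2)"
      by (simp add: scalar_prod_def power2_eq_square atLeast0LessThan z_def)
    also have "\<dots> \<le> (\<Sum>i<n. 1 + t i)"
    proof (rule sum_mono)
      fix i assume "i \<in> {..<n}"
      then show "(z $ i)\<^sup>2 \<le> 1 + t i"
        using kt[of i] t0[of i] z_sq[of i] by (cases "\<kappa> i = 1") auto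
    qed
    also have "\<dots> = (1 + \<alpha>) * n" by (simp add: sum.distrib sum_t algebra_simps)
    finally show ?thesis .
  qed
  moreover have "sqrt (\<alpha> * n / \<beta>) \<le> x \<bullet> z"
  proof -
    have "sqrt (\<alpha> * n / \<beta>) = (\<Sum>i<n. sqrt (\<alpha> * n / \<beta>) * (x $ i)\<^sup>2)"
      unfolding sum_distrib_left[symmetric] x1 by simp
    also have "\<dots> \<le> (\<Sum>i<n. x $ i * z $ i)"
    proof (rule sum_mono)
      fix i assume "i \<in> {..<n}"
      then have i: "i < n" by simp
      have "\<beta> ^ \<kappa> i = \<beta> * (z $ i)\<^sup>2" using z_sq[OF i] kr[of i] by (cases "\<kappa> i") auto
      then have "\<alpha> * n / \<beta> * (x $ i)\<^sup>2 \<le> (z $ i)\<^sup>2"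
        using t_le[OF i] b unfolding t_def by (simp add: field_simps)
      then have "sqrt (\<alpha> * n / \<beta> * (x $ i)\<^sup>2) \<le> sqrt ((z $ i)\<^sup>2)" by (rule real_sqrt_le_mono)
      then have "sqrt (\<alpha> * n / \<beta>) * \<bar>x $ i\<bar> \<le> \<bar>z $ i\<bar>"
        by (simp only: real_sqrt_mult[of _ "(x $ i)\<^sup>2"] real_sqrt_abs)
      then have "sqrt (\<alpha> * n / \<beta>) * \<bar>x $ i\<bar> * \<bar>x $ i\<bar> \<le> \<bar>z $ i\<bar> * \<bar>x $ i\<bar>"
        by (intro mult_right_mono) auto
      also have "\<bar>z $ i\<bar> * \<bar>x $ i\<bar> = x $ i * z $ i" using i unfolding z_def by auto
      finally show "sqrt (\<alpha> * n / \<beta>) * (x $ i)\<^sup>2 \<le> x $ i * z $ i"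
        by (simp add: power2_eq_square mult.assoc)
    qed
    also have "\<dots> = x \<bullet> z" by (simp add: scalar_prod_def z_def atLeast0LessThan)
    finally show ?thesis .
  qed
  ultimately show ?thesis by (rule that)
qed

lemma Z_all_nonzero:
  assumes n: "n \<ge> 2" and z: "z \<in> Z_all n \<alpha> \<beta>"
  shows "z \<in> carrier_vec n" "0 < z \<bullet> z"
proof -
  obtain I where I: "admissible_partition n \<alpha> \<beta> I" and zI: "z \<in> Z_part n \<alpha> \<beta> I"
    using z unfolding Z_all_def by auto
  show zc: "z \<in> carrier_vec n" using zI unfolding Z_part_def by auto
  have "(\<Union>k\<in>{1..m n}. I k) = {0..<n}" using I unfolding admissible_partition_def by auto
  then have "0 \<in> (\<Union>k\<in>{1..m n}. I k)" using n by simp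
  then obtain k where "k \<in> {1..m n}" "0 \<in> I k" by blast
  then have "z $ 0 \<in> {1, - 1, \<beta> powr ((real k - 1) / 2), - (\<beta> powr ((real k - 1) / 2))}"
    using zI unfolding Z_part_def by blast
  then have "0 < (z $ 0)\<^sup>2" using one_le_alpha alpha_le by auto
  also have "\<dots> \<le> (\<Sum>i<n. (z $ i)\<^sup>2)" using n by (intro member_le_sum) auto
  finally show "0 < z \<bullet> z"
    using zc by (simp add: scalar_prod_def power2_eq_square atLeast0LessThan)
qed

text \<open>The approximating grid point even gives the threshold with \<open>\<alpha>\<close> in place of \<open>\<alpha> - 1\<close> in the numerator.\<close>

lemma hitting_set_H3:
  assumes n: "n \<ge> 2" and fin: "finite (Z_all n \<alpha> \<beta>)"
  shows "hitting_set n ((\<alpha> - 1) / sqrt (\<alpha> * (\<alpha> + 1) * \<beta>)) (H3 n \<alpha> \<beta>)"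
proof -
  let ?\<tau> = "(\<alpha> - 1) / sqrt (\<alpha> * (\<alpha> + 1) * \<beta>)"
  have "H3 n \<alpha> \<beta> \<subseteq> unit_sphere n"
  proof
    fix v assume "v \<in> H3 n \<alpha> \<beta>"
    then obtain z where z: "z \<in> Z_all n \<alpha> \<beta>" and v: "v = (1 / vec_norm2 z) \<cdot>\<^sub>v z"
      unfolding H3_def by auto
    note zz = Z_all_nonzero[OF n z]
    have "v \<bullet> v = (1 / vec_norm2 z) * ((1 / vec_norm2 z) * (z \<bullet> z))"
      unfolding v using zz(1) by simp
    also have "\<dots> = 1" using zz(2) unfolding vec_norm2_def by (simp add: divide_simps)
    finally show "v \<in> unit_sphere n"
      using zz(1) v unfolding unit_sphere_def vec_norm2_def by simp
  qed
  moreover have "\<exists>v\<in>H3 n \<alpha> \<beta>. x \<in> spherical_cap n v ?\<tau>" if x: "x \<in> unit_sphere n" for x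
  proof -
    obtain z where z: "z \<in> Z_all n \<alpha> \<beta>" "z \<bullet> z \<le> (1 + \<alpha>) * n" "sqrt (\<alpha> * n / \<beta>) \<le> x \<bullet> z"
      using Z_all_approximates[OF n x] .
    note zz = Z_all_nonzero[OF n z(1)]
    have b: "\<beta> > 0" using one_le_alpha alpha_le by linarith
    have "?\<tau> = (\<alpha> - 1) / (sqrt \<alpha> * sqrt (\<alpha> + 1) * sqrt \<beta>)" by (simp add: real_sqrt_mult)
    also have "\<dots> \<le> \<alpha> / (sqrt \<alpha> * sqrt (\<alpha> + 1) * sqrt \<beta>)"
      using one_le_alpha b by (intro divide_right_mono) auto
    also have "\<dots> = sqrt (\<alpha> * n / \<beta>) / sqrt ((1 + \<alpha>) * n)"
    proof -
      define a where "a = sqrt \<alpha>"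
      have a: "a > 0" "\<alpha> = a * a" using one_le_alpha unfolding a_def by auto
      have "\<alpha> / (a * sqrt (\<alpha> + 1) * sqrt \<beta>) = (a * a) / (a * (sqrt (\<alpha> + 1) * sqrt \<beta>))"
        using a(2) by (simp only: mult.assoc)
      also have "\<dots> = a / (sqrt \<beta> * sqrt (1 + \<alpha>))" using a(1) by (simp add: mult.commute add.commute)
      finally have "\<alpha> / (sqrt \<alpha> * sqrt (\<alpha> + 1) * sqrt \<beta>) = sqrt \<alpha> / (sqrt \<beta> * sqrt (1 + \<alpha>))"
        unfolding a_def .
      moreover have "sqrt (\<alpha> * n / \<beta>) / sqrt ((1 + \<alpha>) * n)
          = (sqrt \<alpha> * sqrt n / sqrt \<beta>) / (sqrt (1 + \<alpha>) * sqrt n)"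
        by (simp only: real_sqrt_mult real_sqrt_divide)
      ultimately show ?thesis
        using n by simp
    qed
    also have "\<dots> \<le> (x \<bullet> z) / sqrt ((1 + \<alpha>) * n)"
      using z(3) one_le_alpha by (intro divide_right_mono) auto
    also have "\<dots> \<le> (x \<bullet> z) / vec_norm2 z"
    proof (rule divide_left_mono)
      show "vec_norm2 z \<le> sqrt ((1 + \<alpha>) * n)" using z(2) by (simp add: vec_norm2_def)
      have "0 \<le> sqrt (\<alpha> * n / \<beta>)" using one_le_alpha b by simp
      then show "0 \<le> x \<bullet> z" using z(3) by linarith
      show "0 < sqrt ((1 + \<alpha>) * n) * vec_norm2 z"
        using zz(2) one_le_alpha n by (simp add: vec_norm2_def)
    qed
    also have "\<dots> = x \<bullet> ((1 / vec_norm2 z) \<cdot>\<^sub>v z)"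
      using x zz(1) unfolding unit_sphere_def by simp
    finally have "x \<in> spherical_cap n ((1 / vec_norm2 z) \<cdot>\<^sub>v z) ?\<tau>"
      using x unfolding spherical_cap_def by simp
    then show ?thesis using z(1) unfolding H3_def by blast
  qed
  ultimately show ?thesis
    using fin unfolding hitting_set_def by (auto simp: H3_def spherical_cap_def)
qed

section \<open>Counting the grid points\<close>

definition profile :: "nat \<Rightarrow> nat \<Rightarrow> nat" where
  "profile n k = (if k = 1 then base_size n else layer_size n k)"

definition layer_values :: "nat \<Rightarrow> real set" where
  "layer_values k = {1, - 1, \<beta> powr ((real k - 1) / 2), - (\<beta> powr ((real k - 1) / 2))}"

text \<open>The layer is recorded together with the value because a grid point can be compatible with several
  admissible partitions: the values \<open>1\<close> and \<open>- 1\<close> occur on every layer.\<close>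

definition labellings :: "nat \<Rightarrow> (nat \<Rightarrow> nat \<times> real) set" where
  "labellings n = {g \<in> {0..<n} \<rightarrow>\<^sub>E Sigma {1..m n} layer_values.
     \<forall>k\<in>{1..m n}. card {i \<in> {0..<n}. fst (g i) = k} = profile n k}"

lemma Z_all_subset_labellings: "Z_all n \<alpha> \<beta> \<subseteq> (\<lambda>g. vec n (snd \<circ> g)) ` labellings n"
proof
  fix z assume "z \<in> Z_all n \<alpha> \<beta>"
  then obtain I where I: "admissible_partition n \<alpha> \<beta> I" and zI: "z \<in> Z_part n \<alpha> \<beta> I"
    unfolding Z_all_def by auto
  have disj: "disjoint_family_on I {1..m n}" and UN: "(\<Union>k\<in>{1..m n}. I k) = {0..<n}"
    using I unfolding admissible_partition_def by auto
  have "\<forall>i\<in>{0..<n}. \<exists>k\<in>{1..m n}. i \<in> I k" unfolding UN[symmetric] by blast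
  then obtain f where f: "\<And>i. i \<in> {0..<n} \<Longrightarrow> f i \<in> {1..m n} \<and> i \<in> I (f i)" by metis
  have fI: "{i \<in> {0..<n}. f i = k} = I k" if k: "k \<in> {1..m n}" for k
  proof
    show "{i \<in> {0..<n}. f i = k} \<subseteq> I k" using f by auto
    show "I k \<subseteq> {i \<in> {0..<n}. f i = k}"
    proof
      fix i assume i: "i \<in> I k"
      then have i0: "i \<in> {0..<n}" using k UN by blast
      then have "f i = k" using f[OF i0] i k disj unfolding disjoint_family_on_def by blast
      then show "i \<in> {i \<in> {0..<n}. f i = k}" using i0 by simp
    qed
  qed
  define g where "g = restrict (\<lambda>i. (f i, z $ i)) {0..<n}"
  have "\<forall>k\<in>{1..m n}. \<forall>i\<in>I k. z $ i \<in> layer_values k"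
    using zI unfolding Z_part_def layer_values_def by simp
  then have zv: "z $ i \<in> layer_values (f i)" if "i \<in> {0..<n}" for i
    using f[OF that] by blast
  have "g \<in> {0..<n} \<rightarrow>\<^sub>E Sigma {1..m n} layer_values"
    unfolding g_def restrict_PiE_iff using f zv by blast
  moreover have "card {i \<in> {0..<n}. fst (g i) = k} = profile n k" if k: "k \<in> {1..m n}" for k
  proof -
    have "{i \<in> {0..<n}. fst (g i) = k} = I k" using fI[OF k] unfolding g_def by auto
    then show ?thesis using card_admissible[OF I] k unfolding profile_def by auto
  qed
  ultimately have "g \<in> labellings n" unfolding labellings_def by blast
  moreover have "z = vec n (snd \<circ> g)"
    using zI unfolding Z_part_def g_def by (intro eq_vecI) auto
  ultimately show "z \<in> (\<lambda>g. vec n (snd \<circ> g)) ` labellings n" by blast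
qed

lemma finite_labellings: "finite (labellings n)"
proof -
  have "finite ({0..<n} \<rightarrow>\<^sub>E Sigma {1..m n} layer_values)"
    by (intro finite_PiE finite_SigmaI) (auto simp: layer_values_def)
  then show ?thesis by (rule finite_subset[rotated]) (auto simp: labellings_def)
qed

lemma finite_Z_all: "finite (Z_all n \<alpha> \<beta>)"
  by (rule finite_subset[OF Z_all_subset_labellings finite_imageI[OF finite_labellings]])

lemma card_H3_le: "card (H3 n \<alpha> \<beta>) \<le> card (labellings n)"
proof -
  have "card (H3 n \<alpha> \<beta>) \<le> card (Z_all n \<alpha> \<beta>)"
    unfolding H3_def using finite_Z_all by (rule card_image_le)
  also have "\<dots> \<le> card ((\<lambda>g. vec n (snd \<circ> g)) ` labellings n)"
    using Z_all_subset_labellings finite_labellings by (intro card_mono) auto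
  also have "\<dots> \<le> card (labellings n)" using finite_labellings by (rule card_image_le)
  finally show ?thesis .
qed

text \<open>The entropy of the limiting proportions \<open>\<alpha> / \<beta> ^ (k - 1)\<close> of the outer layers is obtained by
  summing an arithmetico-geometric series.\<close>

lemma entropy_outer_layers:
  "(\<Sum>k=2..M. \<alpha> / \<beta> ^ (k - 1) * (- ln (\<alpha> / \<beta> ^ (k - 1))))
     \<le> \<alpha> * \<beta> / (\<beta> - 1)\<^sup>2 * ln \<beta> - \<alpha> / (\<beta> - 1) * ln \<alpha>"
proof -
  have b: "\<beta> \<ge> 2" and ab: "\<alpha> < \<beta>" using one_le_alpha alpha_le by linarith+
  define h where "h j = \<alpha> / \<beta> ^ Suc j * (- ln (\<alpha> / \<beta> ^ Suc j))" for j
  have "\<alpha> \<le> \<beta> ^ Suc j" for j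
    using ab b mult_mono[of \<alpha> \<beta> 1 "\<beta> ^ j"] one_le_power[of \<beta> j] one_le_alpha by simp
  then have h0: "0 \<le> h j" for j
    unfolding h_def using b one_le_alpha by (intro mult_nonneg_nonneg) (auto simp: ln_le_zero_iff)
  have h: "h j = \<alpha> * ln \<beta> / \<beta> * (of_nat (Suc j) * (1 / \<beta>) ^ j) - \<alpha> * ln \<alpha> / \<beta> * (1 / \<beta>) ^ j" for j
  proof -
    have "ln (\<alpha> / \<beta> ^ Suc j) = ln \<alpha> - Suc j * ln \<beta>"
      using b one_le_alpha by (simp add: ln_div ln_realpow ln_mult algebra_simps)
    then have "h j = \<alpha> / (\<beta> * \<beta> ^ j) * (Suc j * ln \<beta> - ln \<alpha>)" unfolding h_def by simp
    also have "\<dots> = \<alpha> * ln \<beta> / \<beta> * (Suc j * (1 / \<beta>) ^ j) - \<alpha> * ln \<alpha> / \<beta> * (1 / \<beta>) ^ j"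
      using b by (simp add: power_one_over field_simps)
    finally show ?thesis by simp
  qed
  have "norm (1 / \<beta>) < 1" using b by simp
  then have "(\<lambda>j. \<alpha> * ln \<beta> / \<beta> * (of_nat (Suc j) * (1 / \<beta>) ^ j) - \<alpha> * ln \<alpha> / \<beta> * (1 / \<beta>) ^ j)
      sums (\<alpha> * ln \<beta> / \<beta> * (1 / (1 - 1 / \<beta>)\<^sup>2) - \<alpha> * ln \<alpha> / \<beta> * (1 / (1 - 1 / \<beta>)))"
    by (intro sums_diff sums_mult geometric_deriv_sums geometric_sums)
  then have "h sums (\<alpha> * ln \<beta> / \<beta> * (1 / (1 - 1 / \<beta>)\<^sup>2) - \<alpha> * ln \<alpha> / \<beta> * (1 / (1 - 1 / \<beta>)))"
    unfolding h[symmetric] .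
  also have "\<alpha> * ln \<beta> / \<beta> * (1 / (1 - 1 / \<beta>)\<^sup>2) - \<alpha> * ln \<alpha> / \<beta> * (1 / (1 - 1 / \<beta>))
      = \<alpha> * \<beta> / (\<beta> - 1)\<^sup>2 * ln \<beta> - \<alpha> / (\<beta> - 1) * ln \<alpha>"
  proof -
    define g where "g = \<beta> - 1"
    have "1 - 1 / \<beta> = g / \<beta>" "g > 0" using b unfolding g_def by (simp_all add: field_simps)
    then show ?thesis using b unfolding g_def[symmetric]
      by (simp add: power_divide power2_eq_square)
  qed
  finally have "h sums (\<alpha> * \<beta> / (\<beta> - 1)\<^sup>2 * ln \<beta> - \<alpha> / (\<beta> - 1) * ln \<alpha>)" .
  then have "sum h {..<M - 1} \<le> \<alpha> * \<beta> / (\<beta> - 1)\<^sup>2 * ln \<beta> - \<alpha> / (\<beta> - 1) * ln \<alpha>"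
    using h0 sum_le_suminf[of h "{..<M - 1}"] by (auto simp: sums_iff)
  moreover have "(\<Sum>k=2..M. \<alpha> / \<beta> ^ (k - 1) * (- ln (\<alpha> / \<beta> ^ (k - 1)))) = sum h {..<M - 1}"
    unfolding h_def
  proof (rule sum.reindex_bij_witness[of _ "\<lambda>j. j + 2" "\<lambda>k. k - 2"])
    fix k assume "k \<in> {2..M}"
    then have "Suc (k - 2) = k - 1" "k - 2 < M - 1" "k - 2 + 2 = k" by auto
    then show "k - 2 + 2 = k" "k - 2 \<in> {..<M - 1}"
      "\<alpha> / \<beta> ^ Suc (k - 2) * (- ln (\<alpha> / \<beta> ^ Suc (k - 2)))
        = \<alpha> / \<beta> ^ (k - 1) * (- ln (\<alpha> / \<beta> ^ (k - 1)))" by (simp_all only: lessThan_iff)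
  qed auto
  ultimately show ?thesis by simp
qed

text \<open>The three summands come from the choice of the values, from the entropy of the innermost layer, and from
  the entropy of the outer layers.\<close>

definition growth_exponent :: real where
  "growth_exponent = (1 + \<alpha> / (\<beta> - 1)) * ln 2 + ln (gap_factor \<alpha> (\<beta> - 1))
     + (\<alpha> * \<beta> / (\<beta> - 1)\<^sup>2 * ln \<beta> - \<alpha> / (\<beta> - 1) * ln \<alpha>)"

text \<open>With \<open>p\<close> for the limiting proportion of the innermost layer, the gap factor is \<open>(1 / p) powr p\<close>, with
  value \<open>1\<close> at \<open>p = 0\<close>. Up to \<open>n * p\<close> coordinates contribute its logarithm; each of the \<open>O(ln n)\<close> remaining
  ones costs at most \<open>ln n\<close>, because the weight \<open>p + 1 / n\<close> is at least \<open>1 / n\<close>.\<close>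

lemma base_layer_entropy:
  assumes n: "n \<ge> 2"
  shows "base_size n * (- ln (1 - \<alpha> / (\<beta> - 1) + 1 / n))
    \<le> n * ln (gap_factor \<alpha> (\<beta> - 1)) + (3 + ln n / ln \<beta>) * ln n"
proof -
  define p where "p = 1 - \<alpha> / (\<beta> - 1)"
  define q where "q = p + 1 / n"
  define l where "l = base_size n - n * p"
  have p0: "0 \<le> p" unfolding p_def using one_le_alpha alpha_le by simp
  have q0: "0 < q" "1 / n \<le> q" unfolding q_def using p0 n by (auto intro: add_nonneg_pos)
  have l: "0 \<le> l" "l \<le> 3 + ln n / ln \<beta>"
    using base_size_bounds[OF n] unfolding l_def p_def by linarith+
  have "p * (- ln q) \<le> ln (gap_factor \<alpha> (\<beta> - 1))"
  proof (cases "p = 0")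
    case True
    then have "gap_factor \<alpha> (\<beta> - 1) = 1"
      using one_le_alpha alpha_le unfolding p_def gap_factor_def by (auto simp: field_simps)
    then show ?thesis using True by simp
  next
    case False
    have eq: "p = (\<beta> - 1 - \<alpha>) / (\<beta> - 1)"
      unfolding p_def using one_le_alpha alpha_le by (simp add: field_simps)
    then have "\<beta> - 1 \<noteq> \<alpha>" using False by auto
    then have "gap_factor \<alpha> (\<beta> - 1) = (1 / p) powr p"
      unfolding gap_factor_def eq by simp
    then have "ln (gap_factor \<alpha> (\<beta> - 1)) = p * (- ln p)"
      using p0 False by (simp add: ln_powr ln_div)
    moreover have "p \<le> q" "0 < p" using p0 False unfolding q_def by auto
    then have "ln p \<le> ln q" using q0 by simp
    ultimately show ?thesis using p0 by (simp add: mult_left_mono)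
  qed
  then have 1: "n * (p * (- ln q)) \<le> n * ln (gap_factor \<alpha> (\<beta> - 1))" by (intro mult_left_mono) auto
  have "ln (1 / n) \<le> ln q" using q0 n by simp
  then have "- ln q \<le> ln n" using n by (simp add: ln_div)
  then have "l * (- ln q) \<le> l * ln n" using l by (intro mult_left_mono)
  also have "\<dots> \<le> (3 + ln n / ln \<beta>) * ln n" using l n by (intro mult_right_mono) auto
  finally have "n * (p * (- ln q)) + l * (- ln q)
      \<le> n * ln (gap_factor \<alpha> (\<beta> - 1)) + (3 + ln n / ln \<beta>) * ln n"
    using 1 by linarith
  moreover have "base_size n * (- ln q) = n * (p * (- ln q)) + l * (- ln q)"
    unfolding l_def by (simp add: algebra_simps)
  ultimately show ?thesis unfolding q_def p_def by simp
qed

text \<open>The weight of a pair of a layer \<open>k\<close> and a value is \<open>q k\<close> divided by a bound \<open>c k\<close> on the number of values,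
  so that partitions and values are counted at once: all labellings have the same weight \<open>W\<close>, and the weights
  of all pairs sum to at most \<open>1 + 1 / n\<close>. On the outer layers \<open>- ln (q k)\<close> is nonnegative, which allows their
  sizes to be replaced by the unrounded ones.\<close>

lemma card_labellings_le:
  assumes n: "n \<ge> 2"
  shows "card (labellings n)
    \<le> exp (n * growth_exponent + (1 + (3 + ln n / ln \<beta>) * ln n))"
proof -
  have b: "\<beta> \<ge> 2" using one_le_alpha alpha_le by linarith
  note mb = num_parts_bounds[OF n]
  have split: "{1..m n} = insert 1 {2..m n}" using mb(1) by auto
  define c :: "nat \<Rightarrow> real" where "c k = (if k = 1 then 2 else 4)" for k
  define q where "q k = (if k = 1 then 1 - \<alpha> / (\<beta> - 1) + 1 / n else \<alpha> / \<beta> ^ (k - 1))" for k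
  define W where "W = (\<Prod>k\<in>{1..m n}. (q k / c k) ^ profile n k)"
  have "0 \<le> 1 - \<alpha> / (\<beta> - 1)" using one_le_alpha alpha_le by simp
  then have q0: "0 < q k" for k
    using n one_le_alpha b unfolding q_def by (auto intro: add_nonneg_pos)
  have c0: "0 < c k" for k unfolding c_def by simp
  have card_c: "card (layer_values k) \<le> c k" for k
  proof (cases "k = 1")
    case True
    \<comment> \<open>On the innermost layer \<open>\<beta> powr ((k - 1) / 2)\<close> is \<open>1\<close>, so two of the four values coincide with the others.\<close>
    have "layer_values 1 = {1, - 1}" using b unfolding layer_values_def by auto
    then show ?thesis unfolding True c_def by simp
  next
    case False
    have "card (layer_values k) \<le> 4"
      using card_length[of "[1, - 1, \<beta> powr ((real k - 1) / 2), - (\<beta> powr ((real k - 1) / 2))]"]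
      unfolding layer_values_def by simp
    then show ?thesis using False unfolding c_def by simp
  qed
  have sum_q: "(\<Sum>k\<in>{1..m n}. q k) \<le> 1 + 1 / n"
  proof -
    have "(\<Sum>k\<in>{1..m n}. q k) = q 1 + (\<Sum>k=2..m n. \<alpha> / \<beta> ^ (k - 1))"
      unfolding split by (subst sum.insert) (auto simp: q_def)
    also have "\<dots> \<le> 1 + 1 / n"
      unfolding sum_outer_fractions[OF mb(1)] q_def using one_le_alpha b by simp
    finally show ?thesis .
  qed
  have "card (labellings n) * W
      \<le> (\<Sum>a\<in>Sigma {1..m n} layer_values. q (fst a) / c (fst a)) ^ card {0..<n}"
  proof (rule card_mult_weight_le)
    show "finite (Sigma {1..m n} layer_values)" by (auto simp: layer_values_def)
    show "0 \<le> q (fst a) / c (fst a)" for a using q0[of "fst a"] c0[of "fst a"] by simp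
    show "labellings n \<subseteq> {0..<n} \<rightarrow>\<^sub>E Sigma {1..m n} layer_values"
      unfolding labellings_def by auto
    fix g assume g: "g \<in> labellings n"
    have "(\<Prod>i\<in>{0..<n}. q (fst (g i)) / c (fst (g i)))
        = (\<Prod>k\<in>{1..m n}. \<Prod>i\<in>{i. i \<in> {0..<n} \<and> fst (g i) = k}. q (fst (g i)) / c (fst (g i)))"
      using g by (intro prod.group[symmetric]) (auto simp: labellings_def PiE_def Pi_def)
    also have "\<dots> = W" unfolding W_def using g
      by (intro prod.cong) (auto simp: labellings_def)
    finally show "(\<Prod>i\<in>{0..<n}. q (fst (g i)) / c (fst (g i))) = W" .
  qed simp
  also have "(\<Sum>a\<in>Sigma {1..m n} layer_values. q (fst a) / c (fst a))
      = (\<Sum>k\<in>{1..m n}. card (layer_values k) * (q k / c k))"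
  proof -
    have "(\<Sum>a\<in>Sigma {1..m n} layer_values. q (fst a) / c (fst a))
        = (\<Sum>k\<in>{1..m n}. \<Sum>v\<in>layer_values k. q k / c k)"
      by (subst sum.Sigma) (auto simp: layer_values_def case_prod_beta)
    then show ?thesis by simp
  qed
  also have "(\<dots>) ^ card {0..<n} \<le> (1 + 1 / n) ^ n"
  proof -
    have "card (layer_values k) * (q k / c k) \<le> c k * (q k / c k)" for k
      using q0[of k] c0[of k] card_c[of k] by (intro mult_right_mono) auto
    then have "(\<Sum>k\<in>{1..m n}. card (layer_values k) * (q k / c k)) \<le> (\<Sum>k\<in>{1..m n}. q k)"
      using c0 by (intro sum_mono) (metis less_irrefl nonzero_mult_div_cancel_left times_divide_eq_right)
    then show ?thesis using sum_q q0 c0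
      by (auto intro!: power_mono sum_nonneg mult_nonneg_nonneg divide_nonneg_nonneg
          simp: less_imp_le)
  qed
  also have "\<dots> \<le> exp (1 / n) ^ n" by (intro power_mono exp_ge_add_one_self) auto
  also have "\<dots> = exp 1" using n by (simp add: exp_of_nat_mult[symmetric])
  finally have main: "card (labellings n) * W \<le> exp 1" .
  have W0: "0 < W" unfolding W_def using q0 c0 by (intro prod_pos) auto
  have "- ln W = (\<Sum>k\<in>{1..m n}. profile n k * (ln (c k) - ln (q k)))"
    unfolding W_def using q0 c0
    by (subst ln_prod) (auto simp: ln_realpow ln_div sum_negf[symmetric] algebra_simps
        less_imp_neq[symmetric] intro!: sum.cong)
  also have "\<dots> = base_size n * (ln 2 - ln (q 1))
      + (\<Sum>k=2..m n. layer_size n k * (2 * ln 2 - ln (q k)))"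
  proof -
    have "ln 4 = 2 * ln (2::real)" using ln_realpow[of 2 2] by simp
    then show ?thesis unfolding split
      by (subst sum.insert) (auto simp: profile_def c_def intro!: sum.cong)
  qed
  also have "\<dots> = (base_size n + 2 * real (\<Sum>k=2..m n. layer_size n k)) * ln 2
      + base_size n * (- ln (q 1)) + (\<Sum>k=2..m n. layer_size n k * (- ln (q k)))"
    by (simp add: algebra_simps sum.distrib sum_subtractf sum_distrib_left sum_distrib_right sum_negf)
  also have "\<dots> \<le> n * growth_exponent + (3 + ln n / ln \<beta>) * ln n"
  proof -
    have "base_size n + 2 * real (\<Sum>k=2..m n. layer_size n k)
        = n + real (\<Sum>k=2..m n. layer_size n k)"
      unfolding base_size_def using sum_layer_size_le_dim[OF n] by (simp add: of_nat_diff)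
    also have "\<dots> \<le> n * (1 + \<alpha> / (\<beta> - 1))"
      using sum_layer_size_le[OF n] by (simp add: distrib_left)
    finally have 1: "(base_size n + 2 * real (\<Sum>k=2..m n. layer_size n k)) * ln 2
        \<le> n * (1 + \<alpha> / (\<beta> - 1)) * ln 2" by (intro mult_right_mono) auto
    have 2: "base_size n * (- ln (q 1))
        \<le> n * ln (gap_factor \<alpha> (\<beta> - 1)) + (3 + ln n / ln \<beta>) * ln n"
      using base_layer_entropy[OF n] unfolding q_def by simp
    have "(\<Sum>k=2..m n. layer_size n k * (- ln (q k)))
        \<le> (\<Sum>k=2..m n. n * (\<alpha> / \<beta> ^ (k - 1) * (- ln (\<alpha> / \<beta> ^ (k - 1)))))"
    proof (rule sum_mono)
      fix k assume k: "k \<in> {2..m n}"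
      then obtain j where j: "k = Suc (Suc j)" by (metis atLeastAtMost_iff le_add_diff_inverse add_2_eq_Suc)
      have "\<alpha> \<le> \<beta> ^ (k - 1)"
        using b one_le_alpha alpha_le mult_mono[of \<alpha> \<beta> 1 "\<beta> ^ j"] one_le_power[of \<beta> j]
        unfolding j by simp
      then have "0 \<le> - ln (\<alpha> / \<beta> ^ (k - 1))" using b one_le_alpha by (simp add: ln_le_zero_iff)
      then have "layer_size n k * (- ln (\<alpha> / \<beta> ^ (k - 1)))
          \<le> n * (\<alpha> / \<beta> ^ (k - 1)) * (- ln (\<alpha> / \<beta> ^ (k - 1)))"
        by (intro mult_right_mono real_layer_size)
      then show "layer_size n k * (- ln (q k))
          \<le> n * (\<alpha> / \<beta> ^ (k - 1) * (- ln (\<alpha> / \<beta> ^ (k - 1))))"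
        using k by (simp add: q_def mult.assoc)
    qed
    also have "\<dots> \<le> n * (\<alpha> * \<beta> / (\<beta> - 1)\<^sup>2 * ln \<beta> - \<alpha> / (\<beta> - 1) * ln \<alpha>)"
      unfolding sum_distrib_left[symmetric] by (intro mult_left_mono entropy_outer_layers) auto
    finally have 3: "(\<Sum>k=2..m n. layer_size n k * (- ln (q k)))
        \<le> n * (\<alpha> * \<beta> / (\<beta> - 1)\<^sup>2 * ln \<beta> - \<alpha> / (\<beta> - 1) * ln \<alpha>)" .
    have "n * growth_exponent = n * (1 + \<alpha> / (\<beta> - 1)) * ln 2 + n * ln (gap_factor \<alpha> (\<beta> - 1))
        + n * (\<alpha> * \<beta> / (\<beta> - 1)\<^sup>2 * ln \<beta> - \<alpha> / (\<beta> - 1) * ln \<alpha>)"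
      unfolding growth_exponent_def by (simp add: distrib_left)
    then show ?thesis using 1 2 3 by linarith
  qed
  finally have lnW: "- ln W \<le> n * growth_exponent + (3 + ln n / ln \<beta>) * ln n" .
  have "card (labellings n) \<le> exp 1 / W" using main W0 by (simp add: pos_le_divide_eq)
  also have "\<dots> = exp (1 + - ln W)" unfolding exp_add exp_minus using W0 by (simp add: divide_inverse)
  also have "\<dots> \<le> exp (n * growth_exponent + (1 + (3 + ln n / ln \<beta>) * ln n))"
    using lnW by simp
  finally show ?thesis .
qed

lemma exp_growth_exponent:
  assumes "\<beta> = \<gamma> + 1"
  shows "exp growth_exponent = 2 powr ((\<gamma> + \<alpha>) / \<gamma>) * \<alpha> powr (- \<alpha> / \<gamma>)
    * (\<gamma> + 1) powr (\<alpha> * (\<gamma> + 1) / \<gamma>\<^sup>2) * gap_factor \<alpha> \<gamma>"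
proof -
  have g: "\<gamma> > 0" using one_le_alpha alpha_le assms by linarith
  have "gap_factor \<alpha> \<gamma> > 0"
    using one_le_alpha alpha_le assms unfolding gap_factor_def by auto
  moreover have "growth_exponent = (\<gamma> + \<alpha>) / \<gamma> * ln 2 + - \<alpha> / \<gamma> * ln \<alpha>
      + \<alpha> * (\<gamma> + 1) / \<gamma>\<^sup>2 * ln (\<gamma> + 1) + ln (gap_factor \<alpha> \<gamma>)"
    unfolding growth_exponent_def unfolding assms using g by (simp add: add_divide_distrib)
  ultimately have "exp growth_exponent = exp ((\<gamma> + \<alpha>) / \<gamma> * ln 2) * exp (- \<alpha> / \<gamma> * ln \<alpha>)
      * exp (\<alpha> * (\<gamma> + 1) / \<gamma>\<^sup>2 * ln (\<gamma> + 1)) * gap_factor \<alpha> \<gamma>"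
    by (simp only: exp_add exp_ln)
  then show ?thesis
    using g one_le_alpha by (simp add: powr_def)
qed

end

section \<open>The hitting set theorem\<close>

theorem corollary2p11:
  fixes \<alpha> \<gamma> :: real
  assumes "1 \<le> \<alpha>" and "\<alpha> \<le> \<gamma>"
  shows "\<exists>\<epsilon> :: nat \<Rightarrow> real. \<epsilon> \<longlonglongrightarrow> 0 \<and>
    (\<forall>n\<ge>2. H3 n \<alpha> (\<gamma> + 1) \<in>
       hitting_sets n ((\<alpha> - 1) / sqrt (\<alpha> * (\<alpha> + 1) * (\<gamma> + 1)))
         ((2 powr ((\<gamma> + \<alpha>) / \<gamma>) * \<alpha> powr (- \<alpha> / \<gamma>)
             * (\<gamma> + 1) powr (\<alpha> * (\<gamma> + 1) / \<gamma>\<^sup>2) * gap_factor \<alpha> \<gamma> + \<epsilon> n) ^ n))"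
proof -
  interpret layers \<alpha> "\<gamma> + 1" using assms by unfold_locales auto
  define C where "C = 2 powr ((\<gamma> + \<alpha>) / \<gamma>) * \<alpha> powr (- \<alpha> / \<gamma>)
    * (\<gamma> + 1) powr (\<alpha> * (\<gamma> + 1) / \<gamma>\<^sup>2) * gap_factor \<alpha> \<gamma>"
  have C: "C = exp growth_exponent" unfolding C_def by (rule exp_growth_exponent[symmetric]) simp
  define d where "d = ln (\<gamma> + 1)"
  have d: "d > 0" unfolding d_def using assms by simp
  \<comment> \<open>the \<open>n\<close>-th root of the subexponential factor in the bound of the number of labellings\<close>
  define r where "r n = exp ((1 + (3 + ln (real n) / d) * ln (real n)) / real n)" for n :: nat
  have "r \<longlonglongrightarrow> 1" unfolding r_def using d by real_asymp
  then have "(\<lambda>n. C * r n - C) \<longlonglongrightarrow> C * 1 - C" by (intro tendsto_intros)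
  then have "(\<lambda>n. C * r n - C) \<longlonglongrightarrow> 0" by simp
  moreover have "H3 n \<alpha> (\<gamma> + 1) \<in> hitting_sets n ((\<alpha> - 1) / sqrt (\<alpha> * (\<alpha> + 1) * (\<gamma> + 1)))
      ((C + (C * r n - C)) ^ n)" if n: "n \<ge> 2" for n
  proof -
    have "real (card (H3 n \<alpha> (\<gamma> + 1))) \<le> card (labellings n)" using card_H3_le by simp
    also have "\<dots> \<le> exp (n * growth_exponent + (1 + (3 + ln n / d) * ln n))"
      unfolding d_def by (rule card_labellings_le[OF n])
    also have "\<dots> = (C * r n) ^ n"
      using n unfolding C r_def power_mult_distrib exp_of_nat_mult[symmetric] by (simp add: exp_add)
    finally show ?thesis
      using hitting_set_H3[OF n finite_Z_all] unfolding hitting_sets_def by simp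
  qed
  ultimately show ?thesis unfolding C_def[symmetric] by (intro exI[of _ "\<lambda>n. C * r n - C"]) simp
qed

end
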